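(* Let $\{F(t):t\in\mathbb R^d\}$ be a stochastic process with continuous sample paths, $F(t)>0$ for all $t\in\mathbb R^d$, and $\mathbb E\int_{\mathbb R^d}F(t)\,dt=1$. Let $M(t)=\max_{i\in\mathbb N}U_iF_i(t-T_i)$, $t\in\mathbb R^d$, where $\sum_i\delta_{(U_i,T_i,F_i)}$ is a Poisson point process on $(0,\infty)\times\mathbb R^d\times C(\mathbb R^d)$ with intensity $u^{-2}du\,dt\,\mathbb P_F(df)$. Define a probability law of a random process $W$ with values in $C^+(\mathbb R^d)$ by $$\mathbb P(W\in L)=\int_{C^+(\mathbb R^d)}\int_{\mathbb R^d}\mathbf 1_{\{f(\cdot-t)/f(-t)\in L\}}\,f(-t)\,dt\,\mathbb P_F(df),\qquad L\in\mathcal B(C^+(\mathbb R^d)).$$ Then $W(\mathbf 0)=1$ and $$\{M(t)\}_{t\in\mathbb R^d}\overset{d}{=}\Big\{\max_{i\in\mathbb N}U'_iW_i(t)\Big\}_{t\in\mathbb R^d},$$ where $\sum_i\delta_{U'_i}$ is a Poisson point process on $(0,\infty)$ with intensity $u^{-2}du$ and $W_i$ are i.i.d. copies of $W$ independent of it; i.e. $M$ admits an incremental representation with $t_0=\mathbf 0$ and incremental process $W$.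
   Context: $C(\mathbb R^d)$ and $C^+(\mathbb R^d)$ are the spaces of non-negative, resp. strictly positive, continuous functions on $\mathbb R^d$ with the topology of uniform convergence on compact sets. *)

theory Defs
  imports "HOL-Probability.Probability"
begin

text \<open>C(R^d): non-negative continuous functions; sigma-algebra: the cylinder (evaluation)
  sigma-algebra restricted to continuous functions (= Borel sigma-algebra of the topology
  of locally uniform convergence).\<close>
definition Cspace :: "('d::euclidean_space \<Rightarrow> real) measure" where
  "Cspace = restrict_space (Pi\<^sub>M UNIV (\<lambda>_. borel))
             {f. continuous_on UNIV f \<and> (\<forall>t. 0 \<le> f t)}"

definition Cplus :: "('d::euclidean_space \<Rightarrow> real) measure" where
  "Cplus = restrict_space (Pi\<^sub>M UNIV (\<lambda>_. borel))
             {f. continuous_on UNIV f \<and> (\<forall>t. 0 < f t)}"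

definition count_pts :: "(nat \<Rightarrow> 'o \<Rightarrow> 'a) \<Rightarrow> 'a set \<Rightarrow> 'o \<Rightarrow> ennreal" where
  "count_pts X A \<omega> = (\<Sum>i. indicator A (X i \<omega>))"

definition poisson_pp :: "'o measure \<Rightarrow> 'a measure \<Rightarrow> (nat \<Rightarrow> 'o \<Rightarrow> 'a) \<Rightarrow> bool" where
  "poisson_pp P \<mu> X \<longleftrightarrow>
     prob_space P \<and>
     (\<forall>i. X i \<in> measurable P \<mu>) \<and>
     (\<forall>A\<in>sets \<mu>. emeasure \<mu> A = \<infinity> \<longrightarrow> (AE \<omega> in P. count_pts X A \<omega> = \<infinity>)) \<and>
     (\<forall>A\<in>sets \<mu>. emeasure \<mu> A < \<infinity> \<longrightarrow>
        (\<forall>n::nat. measure P {\<omega>\<in>space P. count_pts X A \<omega> = of_nat n}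
                  = exp (- measure \<mu> A) * measure \<mu> A ^ n / fact n)) \<and>
     (\<forall>(I::nat set) A. finite I \<longrightarrow> (\<forall>i\<in>I. A i \<in> sets \<mu>) \<longrightarrow> disjoint_family_on A I \<longrightarrow>
        prob_space.indep_vars P (\<lambda>_. borel) (\<lambda>i \<omega>. count_pts X (A i) \<omega>) I)"

definition frechet_int :: "real measure" where
  "frechet_int = density (restrict_space lborel {0<..}) (\<lambda>u. ennreal (1 / u\<^sup>2))"

definition incr_law :: "('d::euclidean_space \<Rightarrow> real) measure \<Rightarrow> ('d \<Rightarrow> real) measure" where
  "incr_law PF = measure_of (space Cplus) (sets Cplus)
     (\<lambda>L. \<integral>\<^sup>+ f. indicator (space Cplus) f *
             (\<integral>\<^sup>+ t. indicator L (\<lambda>s. f (s - t) / f (- t)) * ennreal (f (- t)) \<partial>lborel) \<partial>PF)"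

end

theory Submission
  imports Defs
begin

text \<open>
  Both processes have finite-dimensional distributions of the form \<open>exp (- \<Lambda>)\<close>. The event
  \<open>M(s) \<le> x\<^sub>s\<close> for all \<open>s \<in> J\<close> says that the Poisson process \<open>(U\<^sub>i, T\<^sub>i, F\<^sub>i)\<close> has no point in the set
  where \<open>u f(s - t) > x\<^sub>s\<close> for some \<open>s \<in> J\<close>. The same event for \<open>max U'\<^sub>i W\<^sub>i\<close> says that the
  process \<open>U'\<close>, independently marked with \<open>W\<close>, has no point in the corresponding set; its
  probability follows from the Laplace functional of \<open>U'\<close>. The two exponents agree, since for
  fixed \<open>f\<close> and \<open>t\<close> the substitution \<open>v = u / f(-t)\<close> turns \<open>u^(-2) du\<close> into \<open>v^(-2) dv / f(-t)\<close>, and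
  this factor is cancelled by the weight \<open>f(-t)\<close> in the law of \<open>W\<close>.
\<close>

subsection \<open>The Laplace functional of a Poisson process\<close>

text \<open>Void probabilities are \<open>exp (- \<mu>(A))\<close> also when \<open>\<mu>(A) = \<infinity>\<close>, so no finiteness assumption is
  needed if the exponential is taken on \<open>ennreal\<close>.\<close>

definition exp_neg :: "ennreal \<Rightarrow> ennreal" where
  "exp_neg x = (if x = \<top> then 0 else ennreal (exp (- enn2real x)))"

lemma exp_neg_0 [simp]: "exp_neg 0 = 1"
  by (simp add: exp_neg_def)

lemma exp_neg_top [simp]: "exp_neg \<top> = 0"
  by (simp add: exp_neg_def)

lemma exp_neg_ennreal: "0 \<le> r \<Longrightarrow> exp_neg (ennreal r) = ennreal (exp (- r))"
  by (simp add: exp_neg_def)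

lemma exp_neg_le_1: "exp_neg x \<le> 1"
  by (cases x) (auto simp: exp_neg_ennreal simp flip: ennreal_1)

lemma exp_neg_less_1: "x \<noteq> 0 \<Longrightarrow> exp_neg x < 1"
  by (cases x) (auto simp: exp_neg_ennreal ennreal_less_iff simp flip: ennreal_1)

lemma exp_neg_add: "exp_neg (x + y) = exp_neg x * exp_neg y"
  by (cases x; cases y)
     (auto simp: exp_neg_ennreal mult_exp_exp simp flip: ennreal_plus ennreal_mult)

lemma antimono_exp_neg: "x \<le> y \<Longrightarrow> exp_neg y \<le> exp_neg x"
  by (metis exp_neg_add exp_neg_le_1 le_iff_add mult.right_neutral mult_left_mono zero_le)

lemma exp_neg_sum: "exp_neg (\<Sum>i\<in>I. f i) = (\<Prod>i\<in>I. exp_neg (f i))"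
  by (induction I rule: infinite_finite_induct) (auto simp: exp_neg_add)

lemma exp_neg_mult_of_nat: "exp_neg (x * of_nat n) = exp_neg x ^ n"
  by (induction n) (auto simp: exp_neg_add distrib_left)

lemma measurable_exp_neg [measurable]: "exp_neg \<in> borel_measurable borel"
  unfolding exp_neg_def[abs_def] by measurable

text \<open>This is the inverse of \<open>exp_neg\<close> on [0, 1], with
  \<open>nlog 0 = \<top>\<close>. It rewrites a product of probabilities, some of which may vanish,
  as \<open>exp_neg\<close> of a sum, which is the form the Laplace functional accepts.\<close>

definition nlog :: "ennreal \<Rightarrow> ennreal" where
  "nlog y = (if y = 0 then \<top> else ennreal (- ln (enn2real y)))"

lemma measurable_nlog [measurable]: "nlog \<in> borel_measurable borel"
  unfolding nlog_def[abs_def] by measurable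

lemma exp_neg_nlog: "y \<le> 1 \<Longrightarrow> exp_neg (nlog y) = y"
proof (cases y)
  case (real r)
  assume "y \<le> 1"
  with real have r: "0 \<le> r" "r \<le> 1"
    by (auto simp flip: ennreal_1)
  then show ?thesis
    using real by (cases "r = 0") (auto simp: exp_neg_ennreal nlog_def)
qed (simp add: top_unique)

text \<open>At a finite limit the arguments are eventually finite and the real exponential is
  continuous. At the limit \<top> the arguments eventually exceed any level \<open>- ln e'\<close>,
  so the values fall below any positive bound.\<close>

lemma tendsto_exp_neg:
  assumes f: "(f \<longlongrightarrow> x) F"
  shows "((\<lambda>i. exp_neg (f i)) \<longlongrightarrow> exp_neg x) F"
proof (cases x)
  case (real r)
  have "eventually (\<lambda>i. f i < \<top>) F"
    using f real by (intro order_tendstoD) auto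
  then have "eventually (\<lambda>i. ennreal (exp (- enn2real (f i))) = exp_neg (f i)) F"
    by eventually_elim (auto simp: exp_neg_def)
  moreover have "((\<lambda>i. ennreal (exp (- enn2real (f i)))) \<longlongrightarrow> ennreal (exp (- r))) F"
    using f real by (intro tendsto_intros) auto
  ultimately show ?thesis
    using real by (simp add: exp_neg_ennreal tendsto_cong)
next
  case top
  have "eventually (\<lambda>i. exp_neg (f i) < e) F" if "0 < e" for e
  proof -
    \<comment> \<open>The bound \<open>e\<close> may be infinite; a finite positive real below it
      has a logarithm.\<close>
    from \<open>0 < e\<close> obtain e' where e': "0 < ennreal e'" "ennreal e' < e" "0 < e'"
      by (metis dense ennreal_cases ennreal_less_zero_iff order.strict_trans not_less_iff_gr_or_eq top.extremum_strict)
    have "eventually (\<lambda>i. ennreal (- ln e') < f i) F"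
      using f top by (intro order_tendstoD) auto
    then show ?thesis
    proof eventually_elim
      case (elim i)
      have "exp_neg (f i) \<le> ennreal e'"
      proof (cases "f i")
        case (real s)
        \<comment> \<open>If \<open>e' > 1\<close>, then \<open>- ln e'\<close> is negative and
          \<open>ennreal\<close> truncates it to 0; the inequality then follows from
          \<open>s\<close> being non-negative.\<close>
        with elim have "- ln e' < s" by (cases "0 \<le> - ln e'") (auto simp: ennreal_less_iff)
        then have "exp (- s) \<le> exp (ln e')" by simp
        then show ?thesis using real e' by (simp add: exp_neg_ennreal ennreal_leI)
      qed auto
      with e' show ?case by order
    qed
  qed
  then show ?thesis
    using top by (auto intro!: order_tendstoI)
qed

section \<open>Counting variables, void probabilities and the Laplace functional\<close>

lemma measurable_count_pts [measurable]:
  assumes "\<And>i. X i \<in> measurable P \<mu>" and [measurable]: "A \<in> sets \<mu>"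
  shows "count_pts X A \<in> borel_measurable P"
proof -
  note assms(1)[measurable]
  show ?thesis unfolding count_pts_def[abs_def] by measurable
qed

lemma poisson_pp_measurable: "poisson_pp P \<mu> X \<Longrightarrow> X i \<in> measurable P \<mu>"
  by (simp add: poisson_pp_def)

text \<open>This is the Poisson generating function \<open>exp (- (m * (1 - r)))\<close> at
  \<open>r = exp_neg y\<close>. If the mean is infinite, the count is almost surely infinite, and
  the two sides agree by the arithmetic of \<top>.\<close>

lemma poisson_pp_laplace_count:
  assumes X: "poisson_pp P \<mu> X" and A: "A \<in> sets \<mu>"
  shows "(\<integral>\<^sup>+\<omega>. exp_neg (y * count_pts X A \<omega>) \<partial>P) = exp_neg ((1 - exp_neg y) * emeasure \<mu> A)"
proof -
  interpret prob_space P using X by (simp add: poisson_pp_def)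
  have N [measurable]: "count_pts X A \<in> borel_measurable P"
    using poisson_pp_measurable[OF X] A by (rule measurable_count_pts)
  show ?thesis
  proof (cases "emeasure \<mu> A")
    case top
    then have "AE \<omega> in P. count_pts X A \<omega> = \<infinity>"
      using X A by (auto simp: poisson_pp_def)
    then have "(\<integral>\<^sup>+\<omega>. exp_neg (y * count_pts X A \<omega>) \<partial>P) = (\<integral>\<^sup>+\<omega>. exp_neg (y * \<top>) \<partial>P)"
      by (intro nn_integral_cong_AE) auto
    also have "\<dots> = exp_neg (y * \<top>)"
      by (simp add: emeasure_space_1)
    also have "\<dots> = exp_neg ((1 - exp_neg y) * \<top>)"
    \<comment> \<open>For \<open>y = 0\<close> the convention \<open>0 * \<top> = 0\<close> makes
      both sides 1. Otherwise both arguments are \<top> and both sides are 0.\<close>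
    proof (cases "y = 0")
      case False
      then have "1 - exp_neg y \<noteq> 0"
        using diff_gr0_ennreal[OF exp_neg_less_1, of y] by auto
      with False show ?thesis by (simp add: ennreal_mult_top)
    qed simp
    finally show ?thesis using top by simp
  next
    case (real m)
    obtain r where r: "exp_neg y = ennreal r" "0 \<le> r" "r \<le> 1"
      using exp_neg_le_1[of y] by (metis ennreal_cases ennreal_le_1 ennreal_one_neq_top top_unique)
    define E where "E n = {\<omega>\<in>space P. count_pts X A \<omega> = of_nat n}" for n
    have E [measurable]: "E n \<in> sets P" for n unfolding E_def by measurable
    have m: "measure \<mu> A = m" using real by (simp add: measure_def)
    have PE: "emeasure P (E n) = ennreal (exp (- m) * m ^ n / fact n)" for n
      using X A real m by (auto simp: poisson_pp_def E_def emeasure_eq_measure)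
    \<comment> \<open>The exponential series is used twice: at \<open>s = 1\<close> it shows that
      the Poisson weights have total mass 1, and at \<open>s = r\<close> it gives the
      transform.\<close>
    have gen: "(\<Sum>n. ennreal (exp (- m) * m ^ n / fact n) * ennreal s ^ n) = ennreal (exp (- (m * (1 - s))))"
      if "0 \<le> s" for s
    proof -
      have "(\<lambda>n. (m * s) ^ n /\<^sub>R fact n) sums exp (m * s)" by (rule exp_converges)
      then have "(\<lambda>n. exp (- m) * ((m * s) ^ n /\<^sub>R fact n)) sums (exp (- m) * exp (m * s))" by (rule sums_mult)
      also have "exp (- m) * exp (m * s) = exp (- (m * (1 - s)))" unfolding mult_exp_exp by (simp add: algebra_simps)
      also have "(\<lambda>n. exp (- m) * ((m * s) ^ n /\<^sub>R fact n)) = (\<lambda>n. exp (- m) * m ^ n / fact n * s ^ n)"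
        by (auto simp: field_simps power_mult_distrib)
      finally have "(\<lambda>n. exp (- m) * m ^ n / fact n * s ^ n) sums exp (- (m * (1 - s)))" .
      then have "(\<Sum>n. ennreal (exp (- m) * m ^ n / fact n * s ^ n)) = ennreal (exp (- (m * (1 - s))))"
        using that real by (intro suminf_ennreal_eq) auto
      then show ?thesis
        using that real by (simp add: ennreal_power flip: ennreal_mult)
    qed
    have disj: "disjoint_family E" by (auto simp: disjoint_family_on_def E_def)
    \<comment> \<open>\<open>poisson_pp\<close> prescribes only the probabilities of the finite
      values of the count. As these sum to 1, the count is almost surely finite.\<close>
    have "emeasure P (\<Union>n. E n) = (\<Sum>n. emeasure P (E n))"
      using disj by (intro suminf_emeasure[symmetric]) auto
    also have "\<dots> = 1" using gen[of 1] by (simp add: PE)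
    finally have AE: "AE \<omega> in P. \<omega> \<in> (\<Union>n. E n)"
      by (intro AE_prob_1) (simp add: emeasure_eq_measure)
    have "(\<integral>\<^sup>+\<omega>. exp_neg (y * count_pts X A \<omega>) \<partial>P) = (\<integral>\<^sup>+\<omega>. (\<Sum>n. indicator (E n) \<omega> * exp_neg y ^ n) \<partial>P)"
      using AE
    proof (intro nn_integral_cong_AE, eventually_elim)
      case (elim \<omega>)
      then obtain k where k: "\<omega> \<in> E k" by auto
      then have "indicator (E n) \<omega> * exp_neg y ^ n = (if n = k then exp_neg y ^ k else 0)" for n
        by (auto simp: E_def split: split_indicator)
      then have "(\<Sum>n. indicator (E n) \<omega> * exp_neg y ^ n) = exp_neg y ^ k"
        by (subst suminf_finite[of "{k}"]) auto
      then show ?case using k by (simp add: E_def exp_neg_mult_of_nat)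
    qed
    also have "\<dots> = (\<Sum>n. emeasure P (E n) * exp_neg y ^ n)"
      by (subst nn_integral_suminf) (auto simp: nn_integral_multc)
    also have "\<dots> = ennreal (exp (- (m * (1 - r))))"
      using gen[of r] r by (simp add: PE)
    also have "\<dots> = exp_neg (ennreal (1 - r) * ennreal m)"
      using real r by (simp add: exp_neg_ennreal mult.commute flip: ennreal_mult)
    also have "\<dots> = exp_neg ((1 - exp_neg y) * emeasure \<mu> A)"
      using real r ennreal_minus[of r 1] by simp
    finally show ?thesis .
  qed
qed

text \<open>Taking \<open>y = \<top>\<close> in the Laplace transform turns
  \<open>exp_neg (y * N)\<close> into the indicator of \<open>N = 0\<close>, while
  \<open>1 - exp_neg y\<close> becomes 1.\<close>

lemma poisson_pp_void:
  assumes X: "poisson_pp P \<mu> X" and A: "A \<in> sets \<mu>"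
  shows "emeasure P {\<omega>\<in>space P. \<forall>i. X i \<omega> \<notin> A} = exp_neg (emeasure \<mu> A)"
proof -
  have N [measurable]: "count_pts X A \<in> borel_measurable P"
    using poisson_pp_measurable[OF X] A by (rule measurable_count_pts)
  have eq: "count_pts X A \<omega> = 0 \<longleftrightarrow> (\<forall>i. X i \<omega> \<notin> A)" for \<omega>
    by (auto simp: count_pts_def suminf_eq_zero_iff[OF summableI] indicator_eq_0_iff)
  have "emeasure P {\<omega>\<in>space P. \<forall>i. X i \<omega> \<notin> A} = (\<integral>\<^sup>+\<omega>. indicator {\<omega>\<in>space P. count_pts X A \<omega> = 0} \<omega> \<partial>P)"
    unfolding eq[symmetric] by (rule nn_integral_indicator[symmetric]) measurable
  also have "\<dots> = (\<integral>\<^sup>+\<omega>. exp_neg (\<top> * count_pts X A \<omega>) \<partial>P)"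
    by (intro nn_integral_cong) (auto simp: ennreal_top_mult split: split_indicator)
  also have "\<dots> = exp_neg (emeasure \<mu> A)"
    by (subst poisson_pp_laplace_count[OF X A]) simp
  finally show ?thesis .
qed

text \<open>The level sets of \<open>h\<close> are disjoint, so their counts are independent. The
  expectation factors over the values of \<open>h\<close>, and each factor is the transform of a
  single count.\<close>

lemma poisson_pp_laplace_simple:
  assumes X: "poisson_pp P \<mu> X" and h: "simple_function \<mu> h"
  shows "(\<integral>\<^sup>+\<omega>. exp_neg (\<Sum>i. h (X i \<omega>)) \<partial>P) = exp_neg (\<integral>\<^sup>+x. (1 - exp_neg (h x)) \<partial>\<mu>)"
proof -
  interpret prob_space P using X by (simp add: poisson_pp_def)
  define A where "A y = h -` {y} \<inter> space \<mu>" for y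
  have A: "A y \<in> sets \<mu>" for y unfolding A_def using simple_functionD(2)[OF h] .
  have fin: "finite (h ` space \<mu>)" using simple_functionD(1)[OF h] .
  note X_meas = poisson_pp_measurable[OF X]
  have h_rep: "h x = (\<Sum>y\<in>h ` space \<mu>. y * indicator (A y) x)" if "x \<in> space \<mu>" for x
    unfolding A_def by (rule simple_function_indicator_representation[OF h that])
  \<comment> \<open>Independence in \<open>poisson_pp\<close> is stated for families indexed by
    natural numbers, so the finitely many values of \<open>h\<close> are enumerated.\<close>
  obtain e :: "nat \<Rightarrow> ennreal" where e: "bij_betw e {..<card (h ` space \<mu>)} (h ` space \<mu>)"
    using fin by (metis atLeast0LessThan ex_bij_betw_nat_finite)
  let ?I = "{..<card (h ` space \<mu>)}"
  have ind: "indep_vars (\<lambda>_. borel) (\<lambda>i \<omega>. exp_neg (e i * count_pts X (A (e i)) \<omega>)) ?I"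
  proof -
    have "disjoint_family_on (\<lambda>i. A (e i)) ?I"
      using bij_betw_imp_inj_on[OF e] by (auto simp: disjoint_family_on_def A_def inj_on_def)
    then have "indep_vars (\<lambda>_. borel) (\<lambda>i \<omega>. count_pts X (A (e i)) \<omega>) ?I"
      using X A unfolding poisson_pp_def by auto
    then show ?thesis
      by (rule indep_vars_compose2[where Y="\<lambda>i x. exp_neg (e i * x)"]) measurable
  qed
  have "(\<integral>\<^sup>+\<omega>. exp_neg (\<Sum>i. h (X i \<omega>)) \<partial>P)
      = (\<integral>\<^sup>+\<omega>. (\<Prod>y\<in>h ` space \<mu>. exp_neg (y * count_pts X (A y) \<omega>)) \<partial>P)"
  proof (rule nn_integral_cong)
    fix \<omega> assume "\<omega> \<in> space P"
    then have "h (X i \<omega>) = (\<Sum>y\<in>h ` space \<mu>. y * indicator (A y) (X i \<omega>))" for i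
      by (intro h_rep measurable_space[OF X_meas])
    then have "(\<Sum>i. h (X i \<omega>)) = (\<Sum>y\<in>h ` space \<mu>. \<Sum>i. y * indicator (A y) (X i \<omega>))"
      by (simp add: suminf_sum)
    also have "\<dots> = (\<Sum>y\<in>h ` space \<mu>. y * count_pts X (A y) \<omega>)"
      by (simp add: count_pts_def)
    finally show "exp_neg (\<Sum>i. h (X i \<omega>)) = (\<Prod>y\<in>h ` space \<mu>. exp_neg (y * count_pts X (A y) \<omega>))"
      by (simp add: exp_neg_sum)
  qed
  also have "\<dots> = (\<integral>\<^sup>+\<omega>. (\<Prod>i\<in>?I. exp_neg (e i * count_pts X (A (e i)) \<omega>)) \<partial>P)"
    by (intro nn_integral_cong prod.reindex_bij_betw[OF e, symmetric])
  also have "\<dots> = (\<Prod>i\<in>?I. \<integral>\<^sup>+\<omega>. exp_neg (e i * count_pts X (A (e i)) \<omega>) \<partial>P)"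
    by (rule indep_vars_nn_integral[OF finite_lessThan ind]) simp
  also have "\<dots> = (\<Prod>y\<in>h ` space \<mu>. \<integral>\<^sup>+\<omega>. exp_neg (y * count_pts X (A y) \<omega>) \<partial>P)"
    by (rule prod.reindex_bij_betw[OF e])
  also have "\<dots> = (\<Prod>y\<in>h ` space \<mu>. exp_neg ((1 - exp_neg y) * emeasure \<mu> (A y)))"
    by (simp add: poisson_pp_laplace_count[OF X A])
  also have "\<dots> = exp_neg (\<Sum>y\<in>h ` space \<mu>. (1 - exp_neg y) * emeasure \<mu> (A y))"
    by (simp add: exp_neg_sum)
  also have "(\<Sum>y\<in>h ` space \<mu>. (1 - exp_neg y) * emeasure \<mu> (A y))
      = (\<integral>\<^sup>+x. (\<Sum>y\<in>h ` space \<mu>. (1 - exp_neg y) * indicator (A y) x) \<partial>\<mu>)"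
    using A by (subst nn_integral_sum) (auto simp: nn_integral_cmult_indicator)
  also have "\<dots> = (\<integral>\<^sup>+x. (1 - exp_neg (h x)) \<partial>\<mu>)"
  proof (rule nn_integral_cong)
    fix x assume x: "x \<in> space \<mu>"
    have "(\<Sum>y\<in>h ` space \<mu>. (1 - exp_neg y) * indicator (A y) x)
        = (\<Sum>y\<in>h ` space \<mu>. if y = h x then 1 - exp_neg y else 0)"
      using x by (intro sum.cong) (auto simp: A_def split: split_indicator)
    then show "(\<Sum>y\<in>h ` space \<mu>. (1 - exp_neg y) * indicator (A y) x) = 1 - exp_neg (h x)"
      using x fin by simp
  qed
  finally show ?thesis .
qed

text \<open>Simple functions increase to \<open>h\<close>. The left side passes to the limit by
  dominated convergence with bound 1, the exponent on the right by monotone convergence, as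
  \<open>1 - exp_neg\<close> is increasing.\<close>

theorem poisson_pp_laplace:
  assumes X: "poisson_pp P \<mu> X" and h [measurable]: "h \<in> borel_measurable \<mu>"
  shows "(\<integral>\<^sup>+\<omega>. exp_neg (\<Sum>i. h (X i \<omega>)) \<partial>P) = exp_neg (\<integral>\<^sup>+x. (1 - exp_neg (h x)) \<partial>\<mu>)"
proof -
  interpret prob_space P using X by (simp add: poisson_pp_def)
  note X_meas [measurable] = poisson_pp_measurable[OF X]
  obtain f where f: "\<And>n. simple_function \<mu> (f n)" "incseq f" "\<And>x. (SUP n. f n x) = h x"
    using borel_measurable_implies_simple_function_sequence'[OF h] by metis
  have inc: "incseq (\<lambda>n. f n x)" for x
    using f(2) by (auto simp: incseq_def le_fun_def)
  have f_lim: "(\<lambda>n. f n x) \<longlonglongrightarrow> h x" for x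
    using LIMSEQ_SUP[OF inc] f(3) by simp
  have f_meas [measurable]: "f n \<in> borel_measurable \<mu>" for n
    using f(1) by (rule borel_measurable_simple_function)
  have lim_sum: "(\<lambda>n. \<Sum>i. f n (X i \<omega>)) \<longlonglongrightarrow> (\<Sum>i. h (X i \<omega>))" for \<omega>
  proof -
    have "(\<Sum>i. h (X i \<omega>)) = (SUP n. \<Sum>i. f n (X i \<omega>))"
      unfolding f(3)[symmetric] using inc by (intro ennreal_suminf_SUP_eq) 
    moreover have "incseq (\<lambda>n. \<Sum>i. f n (X i \<omega>))"
      using inc by (auto simp: incseq_def intro!: suminf_le)
    ultimately show ?thesis using LIMSEQ_SUP by metis
  qed
  have "(\<lambda>n. \<integral>\<^sup>+\<omega>. exp_neg (\<Sum>i. f n (X i \<omega>)) \<partial>P) \<longlonglongrightarrow> (\<integral>\<^sup>+\<omega>. exp_neg (\<Sum>i. h (X i \<omega>)) \<partial>P)"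
    by (rule nn_integral_dominated_convergence[where w="\<lambda>_. 1"])
      (auto simp: exp_neg_le_1 emeasure_space_1 intro!: tendsto_exp_neg lim_sum)
  moreover have "(\<lambda>n. exp_neg (\<integral>\<^sup>+x. (1 - exp_neg (f n x)) \<partial>\<mu>)) \<longlonglongrightarrow> exp_neg (\<integral>\<^sup>+x. (1 - exp_neg (h x)) \<partial>\<mu>)"
  proof (rule tendsto_exp_neg, rule nn_integral_LIMSEQ)
    show "incseq (\<lambda>n x. 1 - exp_neg (f n x))"
      using inc by (auto simp: incseq_def le_fun_def intro!: ennreal_minus_mono antimono_exp_neg)
    show "(\<lambda>n. 1 - exp_neg (f n x)) \<longlonglongrightarrow> 1 - exp_neg (h x)" for x
      using exp_neg_le_1[of "h x"]
      by (intro tendsto_diff_ennreal tendsto_const tendsto_exp_neg f_lim) (auto simp: top_unique)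
  qed measurable
  ultimately show ?thesis
    unfolding poisson_pp_laplace_simple[OF X f(1)] by (rule LIMSEQ_unique)
qed

subsection \<open>Independent marking\<close>

lemma tendsto_prod_exp_neg_nlog:
  assumes "\<And>i. G i \<le> 1"
  shows "(\<lambda>n. \<Prod>i<n. G i) \<longlonglongrightarrow> exp_neg (\<Sum>i. nlog (G i))"
proof -
  have "(\<Prod>i<n. G i) = exp_neg (\<Sum>i<n. nlog (G i))" for n
    using assms by (simp add: exp_neg_sum exp_neg_nlog)
  then show ?thesis
    by (simp add: tendsto_exp_neg summable_LIMSEQ)
qed

lemma emeasure_PiM_finite_coords:
  assumes D: "prob_space D" and B: "\<And>i. i < n \<Longrightarrow> B i \<in> sets D"
  shows "emeasure (Pi\<^sub>M (UNIV::nat set) (\<lambda>_. D)) {w\<in>space (Pi\<^sub>M UNIV (\<lambda>_. D)). \<forall>i<n. w i \<in> B i}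
    = (\<Prod>i<n. emeasure D (B i))"
proof -
  have "{w\<in>space (Pi\<^sub>M UNIV (\<lambda>_. D)). \<forall>i<n. w i \<in> B i}
      = prod_emb UNIV (\<lambda>_. D) {..<n} (Pi\<^sub>E {..<n} B)"
    by (auto simp: prod_emb_def space_PiM)
  then show ?thesis
    using emeasure_PiM_emb[of "UNIV::nat set" "\<lambda>_. D" "{..<n}" B] D B by auto
qed

text \<open>Independence refers to the \<open>\<sigma>\<close>-algebra of \<open>K\<close> rather than that of \<open>\<nu>\<close>, as \<open>\<nu>\<close> may live on a
  proper subset of \<open>space K\<close> (here \<open>{0<..}\<close> in the reals).\<close>

theorem poisson_pp_marking_void:
  assumes U: "poisson_pp Q \<nu> U" and K: "(\<lambda>x. x) \<in> measurable \<nu> K"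
    and W: "\<And>i. W i \<in> measurable Q N" "\<And>i. distr Q N (W i) = D"
    and ind_W: "prob_space.indep_vars Q (\<lambda>_. N) W UNIV"
    and ind_UW: "prob_space.indep_set Q
         {(\<lambda>\<omega> i. U i \<omega>) -` A \<inter> space Q | A. A \<in> sets (Pi\<^sub>M (UNIV::nat set) (\<lambda>_. K))}
         {(\<lambda>\<omega> i. W i \<omega>) -` B \<inter> space Q | B. B \<in> sets (Pi\<^sub>M (UNIV::nat set) (\<lambda>_. N))}"
    and S: "S \<in> sets (K \<Otimes>\<^sub>M N)"
  shows "emeasure Q {\<omega>\<in>space Q. \<forall>i. (U i \<omega>, W i \<omega>) \<in> S}
    = exp_neg (\<integral>\<^sup>+u. emeasure D {w\<in>space N. (u, w) \<notin> S} \<partial>\<nu>)"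
proof -
  interpret prob_space Q using U by (simp add: poisson_pp_def)
  have D: "prob_space D" using prob_space_distr[OF W(1)] W(2) by simp
  interpret D: prob_space D by fact
  have sets_D [measurable_cong]: "sets D = sets N" by (metis W(2) sets_distr)
  have space_D: "space D = space N" using sets_D by (rule sets_eq_imp_space_eq)
  note W(1)[measurable] S[measurable] K[measurable]
  have U_meas_\<nu> [measurable]: "U i \<in> measurable Q \<nu>" for i
    using poisson_pp_measurable[OF U] .
  have U_meas [measurable]: "U i \<in> measurable Q K" for i
    using measurable_compose[OF U_meas_\<nu> K] .
  let ?K = "Pi\<^sub>M (UNIV::nat set) (\<lambda>_. K)" and ?N = "Pi\<^sub>M (UNIV::nat set) (\<lambda>_. N)"
  let ?U = "\<lambda>\<omega> i. U i \<omega>" and ?W = "\<lambda>\<omega> i. W i \<omega>"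
  have U_seq [measurable]: "?U \<in> measurable Q ?K" and W_seq [measurable]: "?W \<in> measurable Q ?N"
    by (auto intro!: measurable_PiM_single' simp: space_PiM PiE_iff measurable_space[OF U_meas] measurable_space[OF W(1)])
  \<comment> \<open>Independence of the two sequences is the product formula on rectangles, and
    rectangles determine the joint law. The sequence of points can therefore be fixed while the
    marks are integrated out.\<close>
  have joint: "distr Q ?K ?U \<Otimes>\<^sub>M distr Q ?N ?W = distr Q (?K \<Otimes>\<^sub>M ?N) (\<lambda>\<omega>. (?U \<omega>, ?W \<omega>))"
  proof (rule pair_measure_eqI)
    show "sigma_finite_measure (distr Q ?K ?U)" "sigma_finite_measure (distr Q ?N ?W)"
      by (intro prob_space_imp_sigma_finite prob_space_distr, measurable)+
    fix A B assume AB: "A \<in> sets (distr Q ?K ?U)" "B \<in> sets (distr Q ?N ?W)"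
    then have "prob ((?U -` A \<inter> space Q) \<inter> (?W -` B \<inter> space Q)) = prob (?U -` A \<inter> space Q) * prob (?W -` B \<inter> space Q)"
      by (intro indep_setD[OF ind_UW]) auto
    moreover have "(\<lambda>\<omega>. (?U \<omega>, ?W \<omega>)) -` (A \<times> B) \<inter> space Q = (?U -` A \<inter> space Q) \<inter> (?W -` B \<inter> space Q)"
      by auto
    ultimately show "emeasure (distr Q ?K ?U) A * emeasure (distr Q ?N ?W) B
        = emeasure (distr Q (?K \<Otimes>\<^sub>M ?N) (\<lambda>\<omega>. (?U \<omega>, ?W \<omega>))) (A \<times> B)"
      using AB by (simp add: emeasure_distr emeasure_eq_measure ennreal_mult)
  qed (simp cong: sets_pair_measure_cong)
  have law_W: "distr Q ?N ?W = Pi\<^sub>M UNIV (\<lambda>_. D)"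
    using indep_vars_iff_distr_eq_PiM[where I=UNIV and M'="\<lambda>_. N" and X=W] ind_W W by (simp add: restrict_UNIV)
  interpret PW: prob_space "Pi\<^sub>M (UNIV::nat set) (\<lambda>_. D)"
    using D by (intro prob_space_PiM) auto
  have sets_PiD [measurable_cong]: "sets (Pi\<^sub>M (UNIV::nat set) (\<lambda>_. D)) = sets ?N"
    using sets_D by (intro sets_PiM_cong) auto
  \<comment> \<open>\<open>G u\<close> is the probability that a point at \<open>u\<close> receives
    a mark that keeps the pair in \<open>S\<close>.\<close>
  define G where "G u = emeasure D (Pair u -` S)" for u
  have G_meas [measurable]: "G \<in> borel_measurable K"
    unfolding G_def using S by (intro D.measurable_emeasure_Pair) (simp cong: sets_pair_measure_cong add: sets_D)
  have G_le: "G u \<le> 1" for u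
    unfolding G_def using D.measure_le_1 by (simp add: D.emeasure_eq_measure)
  define T where "T n = {p\<in>space (?K \<Otimes>\<^sub>M ?N). \<forall>i<n. (fst p i, snd p i) \<in> S}" for n
  have T_meas [measurable]: "T n \<in> sets (?K \<Otimes>\<^sub>M ?N)" for n
    unfolding T_def by measurable
  \<comment> \<open>Given the points, the first \<open>n\<close> marks are independent with law
    \<open>D\<close>, so the conditional probability is a product of values of
    \<open>G\<close>.\<close>
  have fin_n: "emeasure Q {\<omega>\<in>space Q. \<forall>i<n. (U i \<omega>, W i \<omega>) \<in> S} = (\<integral>\<^sup>+\<omega>. (\<Prod>i<n. G (U i \<omega>)) \<partial>Q)" for n
  proof -
    have "emeasure Q {\<omega>\<in>space Q. \<forall>i<n. (U i \<omega>, W i \<omega>) \<in> S} = emeasure (distr Q (?K \<Otimes>\<^sub>M ?N) (\<lambda>\<omega>. (?U \<omega>, ?W \<omega>))) (T n)"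
      by (subst emeasure_distr)
         (auto simp: T_def space_pair_measure intro!: arg_cong[where f="emeasure Q"]
           dest: measurable_space[OF U_seq] measurable_space[OF W_seq])
    also have "\<dots> = (\<integral>\<^sup>+u. emeasure (Pi\<^sub>M UNIV (\<lambda>_. D)) (Pair u -` T n) \<partial>distr Q ?K ?U)"
      unfolding joint[symmetric] law_W
      by (rule PW.emeasure_pair_measure_alt) (simp cong: sets_pair_measure_cong add: sets_PiD)
    also have "\<dots> = (\<integral>\<^sup>+u. (\<Prod>i<n. G (u i)) \<partial>distr Q ?K ?U)"
    proof (rule nn_integral_cong)
      fix u assume "u \<in> space (distr Q ?K ?U)"
      then have u: "u \<in> space ?K" by simp
      then have u_i: "u i \<in> space K" for i by (auto simp: space_PiM)
      have "Pair u -` T n = {w\<in>space (Pi\<^sub>M UNIV (\<lambda>_. D)). \<forall>i<n. w i \<in> Pair (u i) -` S}"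
        using u sets_eq_imp_space_eq[OF sets_PiD] by (auto simp: T_def space_pair_measure)
      moreover have "Pair (u i) -` S \<in> sets D" for i
        using sets_Pair1[OF S, of "u i"] by (simp add: sets_D)
      ultimately show "emeasure (Pi\<^sub>M UNIV (\<lambda>_. D)) (Pair u -` T n) = (\<Prod>i<n. G (u i))"
        using emeasure_PiM_finite_coords[OF D, of n "\<lambda>i. Pair (u i) -` S"] by (simp add: G_def)
    qed
    also have "\<dots> = (\<integral>\<^sup>+\<omega>. (\<Prod>i<n. G (U i \<omega>)) \<partial>Q)"
      by (subst nn_integral_distr) auto
    finally show ?thesis .
  qed
  \<comment> \<open>As \<open>n\<close> grows, the events decrease to the full event and the
    products converge boundedly to \<open>exp_neg\<close> of a sum over the points. The Laplace
    functional then applies with \<open>h = nlog \<circ> G\<close>.\<close>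
  have "(\<lambda>n. emeasure Q {\<omega>\<in>space Q. \<forall>i<n. (U i \<omega>, W i \<omega>) \<in> S})
      \<longlonglongrightarrow> emeasure Q (\<Inter>n. {\<omega>\<in>space Q. \<forall>i<n. (U i \<omega>, W i \<omega>) \<in> S})"
    by (rule Lim_emeasure_decseq) (auto simp: decseq_def)
  also have "(\<Inter>n. {\<omega>\<in>space Q. \<forall>i<n. (U i \<omega>, W i \<omega>) \<in> S}) = {\<omega>\<in>space Q. \<forall>i. (U i \<omega>, W i \<omega>) \<in> S}"
    by auto
  finally have "(\<lambda>n. \<integral>\<^sup>+\<omega>. (\<Prod>i<n. G (U i \<omega>)) \<partial>Q) \<longlonglongrightarrow> emeasure Q {\<omega>\<in>space Q. \<forall>i. (U i \<omega>, W i \<omega>) \<in> S}"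
    unfolding fin_n .
  moreover have "(\<lambda>n. \<integral>\<^sup>+\<omega>. (\<Prod>i<n. G (U i \<omega>)) \<partial>Q) \<longlonglongrightarrow> (\<integral>\<^sup>+\<omega>. exp_neg (\<Sum>i. nlog (G (U i \<omega>))) \<partial>Q)"
    by (rule nn_integral_dominated_convergence[where w="\<lambda>_. 1"])
       (auto simp: G_le emeasure_space_1 prod_le_1 intro!: tendsto_prod_exp_neg_nlog)
  ultimately have "emeasure Q {\<omega>\<in>space Q. \<forall>i. (U i \<omega>, W i \<omega>) \<in> S} = (\<integral>\<^sup>+\<omega>. exp_neg (\<Sum>i. nlog (G (U i \<omega>))) \<partial>Q)"
    by (rule LIMSEQ_unique)
  also have "\<dots> = exp_neg (\<integral>\<^sup>+u. (1 - exp_neg (nlog (G u))) \<partial>\<nu>)"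
    using measurable_compose[OF K measurable_compose[OF G_meas measurable_nlog]]
    by (rule poisson_pp_laplace[OF U])
  also have "(\<integral>\<^sup>+u. (1 - exp_neg (nlog (G u))) \<partial>\<nu>) = (\<integral>\<^sup>+u. emeasure D {w\<in>space N. (u, w) \<notin> S} \<partial>\<nu>)"
  proof (rule nn_integral_cong)
    fix u
    have "Pair u -` S \<in> sets D" using sets_Pair1[OF S] by (simp add: sets_D)
    then have "emeasure D (space D - Pair u -` S) = 1 - G u"
      by (subst emeasure_compl) (auto simp: G_def D.emeasure_space_1)
    also have "space D - Pair u -` S = {w\<in>space N. (u, w) \<notin> S}"
      by (auto simp: space_D)
    finally show "1 - exp_neg (nlog (G u)) = emeasure D {w\<in>space N. (u, w) \<notin> S}"
      by (simp add: exp_neg_nlog G_le)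
  qed
  finally show ?thesis .
qed

subsection \<open>Path spaces\<close>

lemma sets_PiM_Iic_cylinder:
  fixes x :: "'i \<Rightarrow> 'b::{linorder_topology, second_countable_topology}"
  assumes "finite J"
  shows "{w. \<forall>j\<in>J. w j \<le> x j} \<in> sets (Pi\<^sub>M UNIV (\<lambda>_. borel))"
proof -
  have "{w\<in>space (Pi\<^sub>M UNIV (\<lambda>_. borel)). \<forall>j\<in>J. w j \<le> x j} \<in> sets (Pi\<^sub>M UNIV (\<lambda>_. borel))"
    using assms by measurable
  then show ?thesis by (simp add: space_PiM)
qed

text \<open>The cylinders over lower half-lines are closed under intersection and generate the
  product \<sigma>-algebra; the empty \<open>J\<close> gives the whole space, which has finite mass.
  Laws of processes can thus be compared through joint distribution functions.\<close>

lemma measure_eqI_Iic_cylinders: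
  fixes M N :: "('i \<Rightarrow> 'b::{linorder_topology, second_countable_topology}) measure"
  assumes M: "prob_space M" "sets M = sets (Pi\<^sub>M UNIV (\<lambda>_. borel))"
    and N: "sets N = sets (Pi\<^sub>M UNIV (\<lambda>_. borel))"
    and eq: "\<And>J x. finite J \<Longrightarrow> emeasure M {w. \<forall>j\<in>J. w j \<le> x j} = emeasure N {w. \<forall>j\<in>J. w j \<le> x j}"
  shows "M = N"
proof -
  define E where "E = {{w :: 'i \<Rightarrow> 'b. \<forall>j\<in>J. w j \<le> x j} | J x. finite J}"
  have E_I: "{w. \<forall>j\<in>J. w j \<le> x j} \<in> E" if "finite J" for J x
    using that by (auto simp: E_def)
  have gen: "sets (Pi\<^sub>M UNIV (\<lambda>_. borel)) = sigma_sets UNIV E"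
  proof
    show "sigma_sets UNIV E \<subseteq> sets (Pi\<^sub>M UNIV (\<lambda>_. borel))"
      using sets.sigma_sets_subset[of E "Pi\<^sub>M UNIV (\<lambda>_. borel)"] sets_PiM_Iic_cylinder by (auto simp: E_def space_PiM)
    \<comment> \<open>Measurability of the identity is the required inclusion of \<sigma>-algebras,
      and it can be checked one coordinate at a time.\<close>
    have "(\<lambda>w. w) \<in> measurable (sigma UNIV E) (Pi\<^sub>M UNIV (\<lambda>_. borel))"
    proof (rule measurable_PiM_single')
      fix i
      show "(\<lambda>w. w i) \<in> borel_measurable (sigma UNIV E)"
      proof (rule borel_measurableI_le)
        fix y
        have "{w. \<forall>j\<in>{i}. w j \<le> y} \<in> E" by (rule E_I) simp
        then show "{w \<in> space (sigma UNIV E). w i \<le> y} \<in> sets (sigma UNIV E)"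
          by (simp add: sigma_sets.Basic)
      qed
    qed simp
    then show "sets (Pi\<^sub>M UNIV (\<lambda>_. borel)) \<subseteq> sigma_sets UNIV E"
      by (auto dest!: measurable_sets simp: space_PiM)
  qed
  show ?thesis
  proof (rule measure_eqI_generator_eq[where E=E and \<Omega>=UNIV and A="\<lambda>_. UNIV"])
    show "Int_stable E"
    proof (rule Int_stableI)
      fix a b assume "a \<in> E" "b \<in> E"
      then obtain J x J' x' where ab: "finite J" "a = {w. \<forall>j\<in>J. w j \<le> x j}"
          "finite J'" "b = {w. \<forall>j\<in>J'. w j \<le> x' j}"
        unfolding E_def by auto
      have "a \<inter> b = {w. \<forall>j\<in>J \<union> J'. w j \<le> (if j \<in> J then if j \<in> J' then min (x j) (x' j) else x j else x' j)}"
        unfolding ab by auto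
      also have "\<dots> \<in> E" using ab by (intro E_I) auto
      finally show "a \<inter> b \<in> E" .
    qed
    show "range (\<lambda>_. UNIV) \<subseteq> E" using E_I[of "{}"] by simp
    show "emeasure M X = emeasure N X" if "X \<in> E" for X using that eq by (auto simp: E_def)
    have "space M = UNIV" using sets_eq_imp_space_eq[OF M(2)] by (simp add: space_PiM)
    then show "emeasure M UNIV \<noteq> \<infinity>" using prob_space.emeasure_space_1[OF M(1)] by simp
  qed (auto simp: M N gen)
qed

text \<open>The product \<sigma>-algebra controls evaluation at fixed points only. A random point is
  a limit of points with finitely many values, for which evaluation is measurable piecewise;
  continuity of the paths carries this to the limit. It is needed because the shift \<open>t\<close>
  in \<open>f (s - t)\<close> is integrated.\<close>

lemma measurable_eval_continuous:
  fixes g :: "'a \<Rightarrow> 'b::{metric_space, second_countable_topology}" and \<Phi> :: "'a \<Rightarrow> 'b \<Rightarrow> 'c::metric_space"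
  assumes \<Phi>: "\<Phi> \<in> measurable M (Pi\<^sub>M UNIV (\<lambda>_. borel))" and g: "g \<in> borel_measurable M"
    and cont: "\<And>x. x \<in> space M \<Longrightarrow> continuous_on UNIV (\<Phi> x)"
  shows "(\<lambda>x. \<Phi> x (g x)) \<in> borel_measurable M"
proof -
  obtain G where G: "\<And>i. simple_function M (G i)" "\<And>x. x \<in> space M \<Longrightarrow> (\<lambda>i. G i x) \<longlonglongrightarrow> g x"
    using borel_measurable_implies_sequence_metric[OF g] by blast
  have eval [measurable]: "(\<lambda>x. \<Phi> x t) \<in> borel_measurable M" for t
    using measurable_compose[OF \<Phi> measurable_component_singleton[of t]] by simp
  show ?thesis
  proof (rule borel_measurable_LIMSEQ_metric)
    show "(\<lambda>x. \<Phi> x (G i x)) \<in> borel_measurable M" for i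
    proof (rule measurable_compose_countable'[of "G i ` space M"])
      show "G i \<in> measurable M (count_space (G i ` space M))"
        using G(1)[of i] by (auto simp: measurable_count_space_eq2 simple_function_def)
      show "countable (G i ` space M)"
        using simple_functionD(1)[OF G(1)] by (rule countable_finite)
    qed measurable
    show "(\<lambda>i. \<Phi> x (G i x)) \<longlonglongrightarrow> \<Phi> x (g x)" if "x \<in> space M" for x
      using continuous_on_tendsto_compose[OF cont[OF that] G(2)[OF that]] by auto
  qed
qed

section \<open>Measurability in the spaces of continuous functions\<close>

lemma space_Cspace: "space Cspace = {f. continuous_on UNIV f \<and> (\<forall>t. 0 \<le> f t)}"
  by (simp add: Cspace_def space_restrict_space space_PiM)

lemma space_Cplus: "space Cplus = {f. continuous_on UNIV f \<and> (\<forall>t. 0 < f t)}"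
  by (simp add: Cplus_def space_restrict_space space_PiM)

lemma measurable_Cspace_eval:
  assumes f: "f \<in> measurable M Cspace" and g: "g \<in> borel_measurable M"
  shows "(\<lambda>x. f x (g x)) \<in> borel_measurable M"
proof (rule measurable_eval_continuous[OF _ g])
  show "f \<in> measurable M (Pi\<^sub>M UNIV (\<lambda>_. borel))"
    using f by (simp add: Cspace_def measurable_restrict_space2_iff)
  show "continuous_on UNIV (f x)" if "x \<in> space M" for x
    using measurable_space[OF f that] by (simp add: space_Cspace)
qed

lemma measurable_CplusI:
  assumes "\<And>t. (\<lambda>x. f x t) \<in> borel_measurable M"
    and "\<And>x. x \<in> space M \<Longrightarrow> f x \<in> space Cplus"
  shows "f \<in> measurable M Cplus"
  unfolding Cplus_def
proof (rule measurable_restrict_space2)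
  show "f \<in> measurable M (Pi\<^sub>M UNIV (\<lambda>_. borel))"
    using assms(1) by (intro measurable_PiM_single') auto
qed (use assms(2) in \<open>auto simp: space_Cplus\<close>)

lemma measurable_Cplus_eval:
  assumes f: "f \<in> measurable M Cplus"
  shows "(\<lambda>x. f x t) \<in> borel_measurable M"
proof -
  have "f \<in> measurable M (Pi\<^sub>M UNIV (\<lambda>_. borel))"
    using f by (simp add: Cplus_def measurable_restrict_space2_iff)
  from measurable_compose[OF this measurable_component_singleton[of t]] show ?thesis by simp
qed

text \<open>A positive continuous function has a positive minimum on each closed ball, hence a lower
  bound \<open>1 / Suc m\<close> at the points of \<open>D\<close> there. Conversely, by density and
  continuity such a bound extends to the whole open ball. For countable \<open>D\<close> this makes
  positivity a countable condition.\<close>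

lemma continuous_on_pos_iff_countable_dense:
  fixes f :: "'d::euclidean_space \<Rightarrow> real"
  assumes D: "\<And>X :: 'd set. open X \<Longrightarrow> X \<noteq> {} \<Longrightarrow> \<exists>d\<in>D. d \<in> X" and f: "continuous_on UNIV f"
  shows "(\<forall>t. 0 < f t) \<longleftrightarrow> (\<forall>n::nat. \<exists>m::nat. \<forall>q\<in>D. norm q < n \<longrightarrow> 1 / real (Suc m) \<le> f q)"
proof safe
  fix n :: nat assume pos: "\<forall>t. 0 < f t"
  have "\<exists>t\<in>cball 0 (real n). \<forall>s\<in>cball 0 (real n). f t \<le> f s"
    by (rule continuous_attains_inf) (auto intro: continuous_on_subset[OF f])
  then obtain t where t: "\<And>s. s \<in> cball 0 (real n) \<Longrightarrow> f t \<le> f s"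
    by blast
  obtain m where m: "1 / real (Suc m) < f t"
    using pos nat_approx_posE by blast
  then show "\<exists>m::nat. \<forall>q\<in>D. norm q < n \<longrightarrow> 1 / real (Suc m) \<le> f q"
    using order.trans[OF less_imp_le[OF m] t] by (intro exI[of _ m]) auto
next
  fix t :: 'd assume *: "\<forall>n::nat. \<exists>m::nat. \<forall>q\<in>D. norm q < n \<longrightarrow> 1 / real (Suc m) \<le> f q"
  obtain n :: nat where n: "norm t < n" using reals_Archimedean2 by blast
  obtain m where m: "\<And>q. q \<in> D \<Longrightarrow> norm q < n \<Longrightarrow> 1 / real (Suc m) \<le> f q" using * by meson
  have "1 / real (Suc m) \<le> f t"
  proof (rule ccontr)
    assume "\<not> 1 / real (Suc m) \<le> f t"
    \<comment> \<open>The part of the ball where \<open>f\<close> is below the bound is open, so if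
      it contained \<open>t\<close> it would contain a point of \<open>D\<close>.\<close>
    then have "t \<in> ball 0 n \<inter> f -` {..< 1 / real (Suc m)}" using n by auto
    moreover have "open (ball 0 n \<inter> f -` {..< 1 / real (Suc m)})"
      using f by (intro open_Int open_vimage) auto
    ultimately obtain q where "q \<in> D" "q \<in> ball 0 n \<inter> f -` {..< 1 / real (Suc m)}"
      using D by blast
    then show False using m[of q] by auto
  qed
  moreover have "0 < 1 / real (Suc m)" by simp
  ultimately show "0 < f t" by linarith
qed

lemma sets_Cspace_pos: "space Cplus \<in> sets (Cspace :: ('d::euclidean_space \<Rightarrow> real) measure)"
proof -
  obtain D :: "'d set" where D: "countable D" "\<And>X. open X \<Longrightarrow> X \<noteq> {} \<Longrightarrow> \<exists>d\<in>D. d \<in> X"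
    by (erule countable_dense_setE)
  have [measurable]: "(\<lambda>f. f t) \<in> borel_measurable Cspace" for t :: 'd
    by (rule measurable_Cspace_eval) auto
  have "{f\<in>space Cspace. \<forall>n::nat. \<exists>m::nat. \<forall>q\<in>D. norm q < n \<longrightarrow> 1 / real (Suc m) \<le> f q} \<in> sets Cspace"
    using D(1) by measurable
  also have "{f\<in>space Cspace. \<forall>n::nat. \<exists>m::nat. \<forall>q\<in>D. norm q < n \<longrightarrow> 1 / real (Suc m) \<le> f q} = space Cplus"
  proof (rule set_eqI)
    fix f :: "'d \<Rightarrow> real"
    show "f \<in> {f\<in>space Cspace. \<forall>n::nat. \<exists>m::nat. \<forall>q\<in>D. norm q < n \<longrightarrow> 1 / real (Suc m) \<le> f q} \<longleftrightarrow> f \<in> space Cplus"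
    proof (cases "continuous_on UNIV f")
      case True
      show ?thesis
        using continuous_on_pos_iff_countable_dense[OF D(2) True] True less_imp_le
        unfolding space_Cspace space_Cplus by blast
    qed (auto simp: space_Cspace space_Cplus)
  qed
  finally show ?thesis .
qed

subsection \<open>The law of the incremental process\<close>

text \<open>This is the shifted path rescaled to be 1 at the origin. The constant path 1 for
  functions outside \<open>Cplus\<close> keeps all values in \<open>Cplus\<close>, so that the map
  is measurable on the whole product space.\<close>

definition tilt :: "('d::euclidean_space \<Rightarrow> real) \<times> 'd \<Rightarrow> 'd \<Rightarrow> real" where
  "tilt p = (if fst p \<in> space Cplus then (\<lambda>s. fst p (s - snd p) / fst p (- snd p)) else (\<lambda>_. 1))"

lemma measurable_tilt_Cspace: "tilt \<in> measurable (Cspace \<Otimes>\<^sub>M (lborel :: 'd::euclidean_space measure)) Cplus"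
proof (rule measurable_CplusI)
  have [measurable]: "(\<lambda>p. fst p (s - snd p)) \<in> borel_measurable (Cspace \<Otimes>\<^sub>M lborel)" for s :: 'd
    by (rule measurable_Cspace_eval) measurable
  have [measurable]: "(\<lambda>p. fst p (- snd p)) \<in> borel_measurable (Cspace \<Otimes>\<^sub>M (lborel :: 'd measure))"
    by (rule measurable_Cspace_eval) measurable
  note sets_Cspace_pos[measurable]
  show "(\<lambda>p. tilt p t) \<in> borel_measurable (Cspace \<Otimes>\<^sub>M lborel)" for t :: 'd
    unfolding tilt_def if_distrib[where f="\<lambda>g. g t"] by measurable
  show "tilt p \<in> space Cplus" if "p \<in> space (Cspace \<Otimes>\<^sub>M lborel)" for p :: "('d \<Rightarrow> real) \<times> 'd"
    by (auto simp: tilt_def space_Cplus less_imp_neq[symmetric] intro!: continuous_intros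
        elim: continuous_on_compose2)
qed

lemma
  fixes PF :: "('d::euclidean_space \<Rightarrow> real) measure"
  assumes sets_PF: "sets PF = sets Cspace"
  shows measurable_tilt: "tilt \<in> measurable (PF \<Otimes>\<^sub>M lborel) Cplus"
    and measurable_eval_neg_snd: "(\<lambda>p. fst p (- snd p)) \<in> borel_measurable (PF \<Otimes>\<^sub>M lborel)"
proof -
  have sets_pair: "sets (PF \<Otimes>\<^sub>M lborel) = sets (Cspace \<Otimes>\<^sub>M (lborel :: 'd measure))"
    using sets_PF by (intro sets_pair_measure_cong) auto
  have "(\<lambda>p. fst p (- snd p)) \<in> borel_measurable (Cspace \<Otimes>\<^sub>M (lborel :: 'd measure))"
    by (rule measurable_Cspace_eval) measurable
  then show "tilt \<in> measurable (PF \<Otimes>\<^sub>M lborel) Cplus"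
    "(\<lambda>p. fst p (- snd p)) \<in> borel_measurable (PF \<Otimes>\<^sub>M lborel)"
    using measurable_tilt_Cspace by (simp_all add: measurable_cong_sets[OF sets_pair refl])
qed

text \<open>\<open>measure_of\<close> takes the values of its set function only when that function
  is a measure. Here it agrees with the image under \<open>tilt\<close> of a weighted product
  measure, so countable additivity comes for free and integrals reduce to
  \<open>PF \<Otimes>\<^sub>M lborel\<close>.\<close>

lemma incr_law_eq_distr:
  fixes PF :: "('d::euclidean_space \<Rightarrow> real) measure"
  assumes "prob_space PF" and sets_PF [measurable_cong]: "sets PF = sets Cspace"
    and pos: "AE f in PF. f \<in> space Cplus"
  shows "incr_law PF = distr (density (PF \<Otimes>\<^sub>M lborel) (\<lambda>p. ennreal (fst p (- snd p)))) Cplus tilt"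
    (is "_ = ?N")
proof -
  interpret prob_space PF by fact
  note tilt_M [measurable] = measurable_tilt[OF sets_PF]
  note w_M [measurable] = measurable_eval_neg_snd[OF sets_PF]
  have emeasure_N: "(\<integral>\<^sup>+ f. indicator (space Cplus) f *
             (\<integral>\<^sup>+ t. indicator L (\<lambda>s. f (s - t) / f (- t)) * ennreal (f (- t)) \<partial>lborel) \<partial>PF) = emeasure ?N L"
    if L [measurable]: "L \<in> sets Cplus" for L
  proof -
    have "emeasure ?N L = (\<integral>\<^sup>+ p. ennreal (fst p (- snd p)) * indicator L (tilt p) \<partial>(PF \<Otimes>\<^sub>M lborel))"
      using measurable_sets[OF tilt_M L]
      by (subst emeasure_distr; (subst emeasure_density)?)
         (auto intro!: nn_integral_cong split: split_indicator)
    also have "\<dots> = (\<integral>\<^sup>+ f. \<integral>\<^sup>+ t. ennreal (f (- t)) * indicator L (tilt (f, t)) \<partial>lborel \<partial>PF)"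
      by (subst lborel.nn_integral_fst[symmetric]) auto
    also have "\<dots> = (\<integral>\<^sup>+ f. indicator (space Cplus) f *
             (\<integral>\<^sup>+ t. indicator L (\<lambda>s. f (s - t) / f (- t)) * ennreal (f (- t)) \<partial>lborel) \<partial>PF)"
      \<comment> \<open>Almost every path lies in \<open>Cplus\<close>, where the indicator is 1 and
        \<open>tilt\<close> takes its main branch.\<close>
      using pos by (intro nn_integral_cong_AE) (auto simp: tilt_def mult.commute)
    finally show ?thesis by simp
  qed
  have "incr_law PF = measure_of (space ?N) (sets ?N) (emeasure ?N)"
    unfolding incr_law_def space_distr sets_distr
    using sets.space_closed emeasure_N by (intro measure_of_eq) (auto simp: sets.sigma_sets_eq)
  then show ?thesis by (simp only: measure_of_of_measure)
qed

section \<open>Reflection of Lebesgue measure and scaling of the intensity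
  \<open>u^(-2) du\<close>\<close>

lemma nn_integral_lborel_reflect:
  fixes f :: "'d::euclidean_space \<Rightarrow> ennreal"
  assumes [measurable]: "f \<in> borel_measurable borel"
  shows "(\<integral>\<^sup>+t. f (- t) \<partial>lborel) = (\<integral>\<^sup>+t. f t \<partial>lborel)"
proof -
  have "(\<integral>\<^sup>+t. f t \<partial>lborel) = (\<integral>\<^sup>+t. f t \<partial>density (distr lborel borel (\<lambda>x::'d. 0 + (-1) *\<^sub>R x)) (\<lambda>_. ennreal (\<bar>-1\<bar> ^ DIM('d))))"
    by (subst lborel_affine[symmetric]) auto
  then show ?thesis by (simp add: nn_integral_density nn_integral_distr)
qed

lemma sets_frechet_int [measurable_cong]: "sets frechet_int = sets (restrict_space borel {0<..})"
  by (simp add: frechet_int_def sets_restrict_space)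

lemma nn_integral_frechet_int:
  assumes [measurable]: "g \<in> borel_measurable borel"
  shows "(\<integral>\<^sup>+u. g u \<partial>frechet_int) = (\<integral>\<^sup>+u. ennreal (1 / u\<^sup>2) * g u * indicator {0<..} u \<partial>lborel)"
  unfolding frechet_int_def
  by (subst nn_integral_density) (auto simp: nn_integral_restrict_space intro!: measurable_restrict_space1)

lemma nn_integral_frechet_int_scale:
  assumes [measurable]: "g \<in> borel_measurable borel" and c: "0 < c"
  shows "ennreal c * (\<integral>\<^sup>+u. g (u / c) \<partial>frechet_int) = (\<integral>\<^sup>+u. g u \<partial>frechet_int)"
proof -
  have scale: "ennreal c * (ennreal c * ennreal (1 / (c * u)\<^sup>2)) = ennreal (1 / u\<^sup>2)" for u
  proof -
    have "ennreal c * (ennreal c * ennreal (1 / (c * u)\<^sup>2)) = ennreal (c * (c * (1 / (c * u)\<^sup>2)))"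
      using c by (simp only: ennreal_mult mult_nonneg_nonneg less_imp_le divide_nonneg_nonneg zero_le_power2 zero_le_one)
    also have "c * (c * (1 / (c * u)\<^sup>2)) = 1 / u\<^sup>2"
      using c by (simp add: power2_eq_square)
    finally show ?thesis .
  qed
  have "ennreal c * (\<integral>\<^sup>+u. g (u / c) \<partial>frechet_int)
      = ennreal c * (\<integral>\<^sup>+u. ennreal (1 / u\<^sup>2) * g (u / c) * indicator {0<..} u \<partial>lborel)"
    by (subst nn_integral_frechet_int) auto
  \<comment> \<open>The substitution of \<open>c * u\<close> for \<open>u\<close> contributes one
    factor \<open>c\<close>; with the factor already in front it cancels the square of
    \<open>c\<close> in the density.\<close>
  also have "\<dots> = ennreal c * (ennreal c * (\<integral>\<^sup>+u. ennreal (1 / (c * u)\<^sup>2) * g u * indicator {0<..} u \<partial>lborel))"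
    using c by (subst nn_integral_real_affine[of _ c 0])
      (auto simp: zero_less_mult_iff indicator_def intro!: nn_integral_cong arg_cong2[where f="(*)"])
  also have "\<dots> = (\<integral>\<^sup>+u. (ennreal c * (ennreal c * ennreal (1 / (c * u)\<^sup>2))) * g u * indicator {0<..} u \<partial>lborel)"
    by (simp add: nn_integral_cmult[symmetric] mult.assoc)
  finally show ?thesis by (simp add: scale nn_integral_frechet_int)
qed

text \<open>The density is finite everywhere on the half-line. Since the total mass is infinite, the
  Fubini arguments rest on this property.\<close>

lemma sigma_finite_frechet_int: "sigma_finite_measure frechet_int"
proof -
  interpret sigma_finite_measure "restrict_space lborel {0::real<..}"
    by (rule sigma_finite_measure_restrict_space[OF lborel.sigma_finite_measure_axioms]) simp
  show ?thesis unfolding frechet_int_def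
    by (subst sigma_finite_iff_density_finite) (auto intro!: measurable_restrict_space1)
qed

section \<open>Integrals, total mass and value at the origin under the incremental law\<close>

lemma nn_integral_incr_law:
  fixes PF :: "('d::euclidean_space \<Rightarrow> real) measure"
  assumes PF: "prob_space PF" and sets_PF: "sets PF = sets Cspace"
    and pos: "AE f in PF. f \<in> space Cplus"
    and h [measurable]: "h \<in> borel_measurable Cplus"
  shows "(\<integral>\<^sup>+w. h w \<partial>incr_law PF) = (\<integral>\<^sup>+p. ennreal (fst p (- snd p)) * h (tilt p) \<partial>(PF \<Otimes>\<^sub>M lborel))"
proof -
  note tilt_M [measurable] = measurable_tilt[OF sets_PF]
  note w_M [measurable] = measurable_eval_neg_snd[OF sets_PF]
  have "(\<integral>\<^sup>+w. h w \<partial>incr_law PF)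
      = (\<integral>\<^sup>+p. h (tilt p) \<partial>density (PF \<Otimes>\<^sub>M lborel) (\<lambda>p. ennreal (fst p (- snd p))))"
    unfolding incr_law_eq_distr[OF PF sets_PF pos]
    by (rule nn_integral_distr) (use tilt_M h in \<open>auto simp: measurable_density_eq1\<close>)
  also have "\<dots> = (\<integral>\<^sup>+p. ennreal (fst p (- snd p)) * h (tilt p) \<partial>(PF \<Otimes>\<^sub>M lborel))"
    by (rule nn_integral_density) (use measurable_compose[OF tilt_M h] w_M in auto)
  finally show ?thesis .
qed

lemma space_incr_law [simp]: "space (incr_law PF) = space Cplus"
  by (simp add: incr_law_def sets.space_closed)

lemma sets_incr_law [simp, measurable_cong]: "sets (incr_law PF) = sets Cplus"
  by (simp add: incr_law_def sets.sigma_sets_eq sets.space_closed)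

text \<open>The total mass is the expected integral of \<open>f (- t)\<close>, which reflection
  turns into the integral of \<open>f t\<close> normalised by \<open>mass\<close>.\<close>

lemma prob_space_incr_law:
  fixes PF :: "('d::euclidean_space \<Rightarrow> real) measure"
  assumes PF: "prob_space PF" and sets_PF [measurable_cong]: "sets PF = sets Cspace"
    and pos: "AE f in PF. f \<in> space Cplus"
    and mass: "(\<integral>\<^sup>+f. \<integral>\<^sup>+t. ennreal (f t) \<partial>lborel \<partial>PF) = 1"
  shows "prob_space (incr_law PF)"
proof
  interpret prob_space PF by fact
  note w_M [measurable] = measurable_eval_neg_snd[OF sets_PF]
  have "emeasure (incr_law PF) (space (incr_law PF)) = (\<integral>\<^sup>+w. 1 \<partial>incr_law PF)"
    by simp
  also have "\<dots> = (\<integral>\<^sup>+p. ennreal (fst p (- snd p)) \<partial>(PF \<Otimes>\<^sub>M lborel))"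
    by (subst nn_integral_incr_law[OF PF sets_PF pos]) auto
  also have "\<dots> = (\<integral>\<^sup>+f. \<integral>\<^sup>+t. ennreal (f (- t)) \<partial>lborel \<partial>PF)"
    by (subst lborel.nn_integral_fst[symmetric]) auto
  also have "\<dots> = (\<integral>\<^sup>+f. \<integral>\<^sup>+t. ennreal (f t) \<partial>lborel \<partial>PF)"
  proof (rule nn_integral_cong)
    fix f assume "f \<in> space PF"
    then have "continuous_on UNIV f"
      using sets_eq_imp_space_eq[OF sets_PF] by (simp add: space_Cspace)
    then have "f \<in> borel_measurable borel" by (rule borel_measurable_continuous_onI)
    then show "(\<integral>\<^sup>+t. ennreal (f (- t)) \<partial>lborel) = (\<integral>\<^sup>+t. ennreal (f t) \<partial>lborel)"
      by (intro nn_integral_lborel_reflect[where f="\<lambda>t. ennreal (f t)"]) measurable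
  qed
  finally show "emeasure (incr_law PF) (space (incr_law PF)) = 1"
    using mass by simp
qed

text \<open>Every value of \<open>tilt\<close> is 1 at the origin, since there numerator and
  denominator are both \<open>f (- t)\<close>; the default path is 1 as well.\<close>

lemma AE_incr_law_0:
  fixes PF :: "('d::euclidean_space \<Rightarrow> real) measure"
  assumes PF: "prob_space PF" and sets_PF: "sets PF = sets Cspace"
    and pos: "AE f in PF. f \<in> space Cplus"
  shows "AE w in incr_law PF. w 0 = 1"
proof -
  have [measurable]: "(\<lambda>w. w 0) \<in> borel_measurable (Cplus :: ('d \<Rightarrow> real) measure)"
    by (rule measurable_Cplus_eval) simp
  have one: "tilt p 0 = 1" for p :: "('d \<Rightarrow> real) \<times> 'd"
    by (auto simp: tilt_def space_Cplus less_imp_neq[symmetric])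
  have ind: "(\<lambda>w. indicator {w :: 'd \<Rightarrow> real. w 0 \<noteq> 1} w :: ennreal) \<in> borel_measurable Cplus"
    by measurable
  have "emeasure (incr_law PF) {w\<in>space Cplus. w 0 \<noteq> 1} = (\<integral>\<^sup>+w. indicator {w. w 0 \<noteq> 1} w \<partial>incr_law PF)"
    by (rule trans[OF nn_integral_indicator[symmetric] nn_integral_cong]) (auto split: split_indicator)
  also have "\<dots> = 0"
    by (subst nn_integral_incr_law[OF PF sets_PF pos ind]) (simp add: one)
  finally show ?thesis
    by (intro AE_I[where N="{w\<in>space Cplus. w 0 \<noteq> 1}"]) auto
qed

section \<open>Equality of the two exponents\<close>

lemma measurable_frechet_int_ident: "(\<lambda>u. u) \<in> measurable frechet_int borel"
  by (auto intro: measurable_restrict_space1 simp: measurable_cong_sets[OF sets_frechet_int refl])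

lemma measurable_shifted_eval:
  fixes PF :: "('d::euclidean_space \<Rightarrow> real) measure"
  assumes sets_PF: "sets PF = sets Cspace"
  shows "(\<lambda>q. ennreal (fst q * snd (snd q) (s - fst (snd q))))
    \<in> borel_measurable (frechet_int \<Otimes>\<^sub>M (lborel \<Otimes>\<^sub>M PF))"
proof -
  have id_PF: "(\<lambda>f. f) \<in> measurable PF Cspace"
    by (simp add: measurable_cong_sets[OF sets_PF refl])
  have [measurable]: "(\<lambda>q. snd (snd q) (s - fst (snd q))) \<in> borel_measurable (frechet_int \<Otimes>\<^sub>M (lborel \<Otimes>\<^sub>M PF))"
    by (rule measurable_Cspace_eval, rule measurable_compose[OF _ id_PF]) measurable
  have [measurable]: "fst \<in> borel_measurable (frechet_int \<Otimes>\<^sub>M (lborel \<Otimes>\<^sub>M PF))"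
    by (rule measurable_compose[OF measurable_fst measurable_frechet_int_ident])
  show ?thesis by measurable
qed

text \<open>Fubini moves the integral over \<open>u\<close> innermost. There \<open>f\<close> and
  \<open>t\<close> are fixed, and scaling by \<open>c = f (- t)\<close> removes both the weight and
  the normalisation of the path. The identity holds in [0, \<infinity>], so infinite exponents are
  covered.\<close>

theorem incr_law_intensity:
  fixes PF :: "('d::euclidean_space \<Rightarrow> real) measure" and x :: "'d \<Rightarrow> ennreal"
  assumes PF: "prob_space PF" and sets_PF [measurable_cong]: "sets PF = sets Cspace"
    and pos: "AE f in PF. f \<in> space Cplus" and J: "finite J"
  shows "(\<integral>\<^sup>+u. emeasure (incr_law PF) {w\<in>space Cplus. \<not> (\<forall>s\<in>J. ennreal (u * w s) \<le> x s)} \<partial>frechet_int)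
    = emeasure (frechet_int \<Otimes>\<^sub>M (lborel \<Otimes>\<^sub>M PF))
        {q\<in>space (frechet_int \<Otimes>\<^sub>M (lborel \<Otimes>\<^sub>M PF)).
          \<not> (\<forall>s\<in>J. ennreal (fst q * snd (snd q) (s - fst (snd q))) \<le> x s)}"
proof -
  interpret PF: prob_space PF by fact
  interpret FR: sigma_finite_measure frechet_int by (rule sigma_finite_frechet_int)
  interpret LP: pair_sigma_finite lborel PF ..
  interpret PL: pair_sigma_finite PF lborel ..
  interpret FPL: pair_sigma_finite frechet_int "PF \<Otimes>\<^sub>M (lborel :: 'd measure)" ..
  note measurable_Cplus_eval[measurable (raw)]
  interpret FLP: pair_sigma_finite frechet_int "(lborel :: 'd measure) \<Otimes>\<^sub>M PF" ..
  \<comment> \<open>This is the indicator that \<open>u * f\<close> exceeds a level at some point of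
    \<open>J\<close>. It depends only on the product \<open>u * f\<close>, so dividing the path by a
    constant amounts to dividing \<open>u\<close> by it.\<close>
  define B where "B u f = (of_bool (\<not> (\<forall>s\<in>J. ennreal (u * f s) \<le> x s)) :: ennreal)" for u f
  have B_meas: "(\<lambda>p. B (U p) (f p)) \<in> borel_measurable M"
    if [measurable]: "U \<in> borel_measurable M" "\<And>s. (\<lambda>p. f p s) \<in> borel_measurable M"
    for U and f :: "_ \<Rightarrow> 'd \<Rightarrow> real" and M :: "'z measure"
    unfolding B_def using J by measurable
  note measurable_frechet_int_ident[measurable]
  note tilt_M [measurable] = measurable_tilt[OF sets_PF]
  note w_M [measurable] = measurable_eval_neg_snd[OF sets_PF]
  have id_PF: "(\<lambda>f. f) \<in> measurable PF Cspace"
    by (simp add: measurable_cong_sets[OF sets_PF refl])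
  have [measurable]: "(\<lambda>p. B (fst p) (tilt (snd p))) \<in> borel_measurable (frechet_int \<Otimes>\<^sub>M (PF \<Otimes>\<^sub>M lborel))"
    by (rule B_meas) measurable
  have ev: "(\<lambda>q. snd (snd q) (s - fst (snd q))) \<in> borel_measurable (frechet_int \<Otimes>\<^sub>M (lborel \<Otimes>\<^sub>M PF))" for s
    by (rule measurable_Cspace_eval, rule measurable_compose[OF _ id_PF]) measurable
  have B_LP [measurable]: "(\<lambda>q. B (fst q) (\<lambda>s. snd (snd q) (s - fst (snd q)))) \<in> borel_measurable (frechet_int \<Otimes>\<^sub>M (lborel \<Otimes>\<^sub>M PF))"
    by (rule B_meas) (use ev in auto)
  have inner_tilt: "(\<lambda>p. \<integral>\<^sup>+u. ennreal (fst p (- snd p)) * B u (tilt p) \<partial>frechet_int) \<in> borel_measurable (PF \<Otimes>\<^sub>M lborel)"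
  proof (rule FR.borel_measurable_nn_integral)
    have "(\<lambda>q. B (snd q) (tilt (fst q))) \<in> borel_measurable ((PF \<Otimes>\<^sub>M lborel) \<Otimes>\<^sub>M frechet_int)"
      by (rule B_meas) measurable
    then show "(\<lambda>(p, u). ennreal (fst p (- snd p)) * B u (tilt p)) \<in> borel_measurable ((PF \<Otimes>\<^sub>M lborel) \<Otimes>\<^sub>M frechet_int)"
      unfolding case_prod_beta' by measurable
  qed
  have inner_shift: "(\<lambda>q. \<integral>\<^sup>+u. B u (\<lambda>s. snd q (s - fst q)) \<partial>frechet_int) \<in> borel_measurable (lborel \<Otimes>\<^sub>M PF)"
  proof (rule FR.borel_measurable_nn_integral)
    have [measurable]: "(\<lambda>q. snd (fst q) (s - fst (fst q))) \<in> borel_measurable ((lborel \<Otimes>\<^sub>M PF) \<Otimes>\<^sub>M frechet_int)" for s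
      by (rule measurable_Cspace_eval, rule measurable_compose[OF _ id_PF]) measurable
    show "(\<lambda>(q, u). B u (\<lambda>s. snd q (s - fst q))) \<in> borel_measurable ((lborel \<Otimes>\<^sub>M PF) \<Otimes>\<^sub>M frechet_int)"
      unfolding case_prod_beta' by (rule B_meas) measurable
  qed
  have scale: "(\<integral>\<^sup>+u. ennreal (f (- t)) * B u (tilt (f, t)) \<partial>frechet_int) = (\<integral>\<^sup>+u. B u (\<lambda>s. f (s - t)) \<partial>frechet_int)"
    if f: "f \<in> space Cplus" for f t
  proof -
    have c: "0 < f (- t)" using f by (simp add: space_Cplus)
    have m: "(\<lambda>u. B u (\<lambda>s. f (s - t))) \<in> borel_measurable borel"
      by (rule B_meas) auto
    have "(\<integral>\<^sup>+u. ennreal (f (- t)) * B u (tilt (f, t)) \<partial>frechet_int)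
        = (\<integral>\<^sup>+u. ennreal (f (- t)) * B (u / f (- t)) (\<lambda>s. f (s - t)) \<partial>frechet_int)"
      using f by (simp add: B_def tilt_def)
    also have "\<dots> = ennreal (f (- t)) * (\<integral>\<^sup>+u. B (u / f (- t)) (\<lambda>s. f (s - t)) \<partial>frechet_int)"
      by (intro nn_integral_cmult B_meas) auto
    also have "\<dots> = (\<integral>\<^sup>+u. B u (\<lambda>s. f (s - t)) \<partial>frechet_int)"
      by (rule nn_integral_frechet_int_scale[OF m c])
    finally show ?thesis .
  qed
  have "(\<integral>\<^sup>+u. emeasure (incr_law PF) {w\<in>space Cplus. \<not> (\<forall>s\<in>J. ennreal (u * w s) \<le> x s)} \<partial>frechet_int)
      = (\<integral>\<^sup>+u. \<integral>\<^sup>+w. B u w \<partial>incr_law PF \<partial>frechet_int)"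
  proof (rule nn_integral_cong)
    fix u :: real
    have "{w\<in>space Cplus. \<not> (\<forall>s\<in>J. ennreal (u * w s) \<le> x s)} \<in> sets Cplus"
      using J by measurable
    then show "emeasure (incr_law PF) {w\<in>space Cplus. \<not> (\<forall>s\<in>J. ennreal (u * w s) \<le> x s)} = (\<integral>\<^sup>+w. B u w \<partial>incr_law PF)"
      by (intro trans[OF nn_integral_indicator[symmetric] nn_integral_cong])
         (auto simp: B_def split: split_indicator)
  qed
  also have "\<dots> = (\<integral>\<^sup>+u. \<integral>\<^sup>+p. ennreal (fst p (- snd p)) * B u (tilt p) \<partial>(PF \<Otimes>\<^sub>M lborel) \<partial>frechet_int)"
    by (intro nn_integral_cong nn_integral_incr_law[OF PF sets_PF pos] B_meas) measurable
  also have "\<dots> = (\<integral>\<^sup>+p. \<integral>\<^sup>+u. ennreal (fst p (- snd p)) * B u (tilt p) \<partial>frechet_int \<partial>(PF \<Otimes>\<^sub>M lborel))"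
    by (rule FPL.Fubini'[symmetric]) (simp add: case_prod_beta')
  also have "\<dots> = (\<integral>\<^sup>+f. \<integral>\<^sup>+t. \<integral>\<^sup>+u. ennreal (f (- t)) * B u (tilt (f, t)) \<partial>frechet_int \<partial>lborel \<partial>PF)"
    by (subst lborel.nn_integral_fst[symmetric]) (use inner_tilt in auto)
  also have "\<dots> = (\<integral>\<^sup>+f. \<integral>\<^sup>+t. \<integral>\<^sup>+u. B u (\<lambda>s. f (s - t)) \<partial>frechet_int \<partial>lborel \<partial>PF)"
    using pos by (intro nn_integral_cong_AE) (auto simp: scale)
  \<comment> \<open>The incremental law integrates over \<open>t\<close> inside \<open>f\<close>,
    whereas the Poisson intensity lists the shift before the path; the order is exchanged
    here.\<close>
  also have "\<dots> = (\<integral>\<^sup>+t. \<integral>\<^sup>+f. \<integral>\<^sup>+u. B u (\<lambda>s. f (s - t)) \<partial>frechet_int \<partial>PF \<partial>lborel)"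
    by (rule LP.Fubini') (use inner_shift in \<open>simp add: case_prod_beta'\<close>)
  also have "\<dots> = (\<integral>\<^sup>+q. \<integral>\<^sup>+u. B u (\<lambda>s. snd q (s - fst q)) \<partial>frechet_int \<partial>(lborel \<Otimes>\<^sub>M PF))"
    by (subst PF.nn_integral_fst[symmetric]) (use inner_shift in auto)
  also have "\<dots> = (\<integral>\<^sup>+u. \<integral>\<^sup>+q. B u (\<lambda>s. snd q (s - fst q)) \<partial>(lborel \<Otimes>\<^sub>M PF) \<partial>frechet_int)"
    by (rule FLP.Fubini') (simp add: case_prod_beta')
  also have "\<dots> = (\<integral>\<^sup>+q. B (fst q) (\<lambda>s. snd (snd q) (s - fst (snd q))) \<partial>(frechet_int \<Otimes>\<^sub>M (lborel \<Otimes>\<^sub>M PF)))"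
    by (subst LP.P.nn_integral_fst[symmetric]) auto
  also have "\<dots> = emeasure (frechet_int \<Otimes>\<^sub>M (lborel \<Otimes>\<^sub>M PF))
        {q\<in>space (frechet_int \<Otimes>\<^sub>M (lborel \<Otimes>\<^sub>M PF)).
          \<not> (\<forall>s\<in>J. ennreal (fst q * snd (snd q) (s - fst (snd q))) \<le> x s)}"
  proof (rule trans[OF nn_integral_cong nn_integral_indicator])
    note measurable_shifted_eval[OF sets_PF, measurable]
    show "{q\<in>space (frechet_int \<Otimes>\<^sub>M (lborel \<Otimes>\<^sub>M PF)).
        \<not> (\<forall>s\<in>J. ennreal (fst q * snd (snd q) (s - fst (snd q))) \<le> x s)}
      \<in> sets (frechet_int \<Otimes>\<^sub>M (lborel \<Otimes>\<^sub>M PF))"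
      using J by measurable
  qed (auto simp: B_def split: split_indicator)
  finally show ?thesis .
qed

subsection \<open>Finite-dimensional distributions\<close>

lemma measurable_shifted_max:
  fixes X :: "nat \<Rightarrow> 'q \<Rightarrow> real \<times> 'd::euclidean_space \<times> ('d \<Rightarrow> real)"
  assumes sets_PF: "sets PF = sets Cspace"
    and X: "\<And>i. X i \<in> measurable P (frechet_int \<Otimes>\<^sub>M (lborel \<Otimes>\<^sub>M PF))"
  shows "(\<lambda>\<omega> t. SUP i. ennreal (fst (X i \<omega>) * snd (snd (X i \<omega>)) (t - fst (snd (X i \<omega>)))))
    \<in> measurable P (Pi\<^sub>M UNIV (\<lambda>_. borel))"
proof (rule measurable_PiM_single')
  fix t
  have [measurable]: "(\<lambda>\<omega>. ennreal (fst (X i \<omega>) * snd (snd (X i \<omega>)) (t - fst (snd (X i \<omega>))))) \<in> borel_measurable P" for i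
    by (rule measurable_compose[OF X measurable_shifted_eval[OF sets_PF]])
  show "(\<lambda>\<omega>. SUP i. ennreal (fst (X i \<omega>) * snd (snd (X i \<omega>)) (t - fst (snd (X i \<omega>))))) \<in> borel_measurable P"
    by measurable
qed simp

text \<open>A supremum is at most \<open>x s\<close> exactly when every term is, so the cylinder
  event is the void event of the exceedance set \<open>?A\<close>. Suprema live in
  \<open>ennreal\<close> and exist without any question of attainment.\<close>

lemma fdd_shifted_max:
  fixes X :: "nat \<Rightarrow> 'q \<Rightarrow> real \<times> 'd::euclidean_space \<times> ('d \<Rightarrow> real)"
  assumes sets_PF: "sets PF = sets Cspace" and J: "finite J"
    and X: "poisson_pp P (frechet_int \<Otimes>\<^sub>M (lborel \<Otimes>\<^sub>M PF)) X"
  shows "emeasure (distr P (Pi\<^sub>M UNIV (\<lambda>_. borel))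
         (\<lambda>\<omega> t. SUP i. ennreal (fst (X i \<omega>) * snd (snd (X i \<omega>)) (t - fst (snd (X i \<omega>))))))
         {w. \<forall>s\<in>J. w s \<le> x s}
    = exp_neg (emeasure (frechet_int \<Otimes>\<^sub>M (lborel \<Otimes>\<^sub>M PF))
        {q\<in>space (frechet_int \<Otimes>\<^sub>M (lborel \<Otimes>\<^sub>M PF)).
          \<not> (\<forall>s\<in>J. ennreal (fst q * snd (snd q) (s - fst (snd q))) \<le> x s)})"
    (is "_ = exp_neg (emeasure ?\<mu> ?A)")
proof -
  note X_meas = poisson_pp_measurable[OF X]
  note measurable_shifted_eval[OF sets_PF, measurable]
  have A: "?A \<in> sets ?\<mu>"
    using J by measurable
  have "(\<lambda>\<omega> t. SUP i. ennreal (fst (X i \<omega>) * snd (snd (X i \<omega>)) (t - fst (snd (X i \<omega>))))) -` {w. \<forall>s\<in>J. w s \<le> x s} \<inter> space P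
      = {\<omega>\<in>space P. \<forall>i. X i \<omega> \<notin> ?A}"
    using measurable_space[OF X_meas] by (auto simp: SUP_le_iff)
  then show ?thesis
    using poisson_pp_void[OF X A]
    by (simp add: emeasure_distr measurable_shifted_max[OF sets_PF X_meas] sets_PiM_Iic_cylinder[OF J])
qed

lemma fdd_incremental_max:
  fixes W :: "nat \<Rightarrow> 'p \<Rightarrow> 'd::euclidean_space \<Rightarrow> real"
  assumes U: "poisson_pp Q frechet_int U"
    and W: "\<And>i. W i \<in> measurable Q Cplus" "\<And>i. distr Q Cplus (W i) = D"
    and ind_W: "prob_space.indep_vars Q (\<lambda>_. Cplus) W UNIV"
    and ind_UW: "prob_space.indep_set Q
         {(\<lambda>\<omega> i. U i \<omega>) -` A \<inter> space Q | A. A \<in> sets (Pi\<^sub>M (UNIV::nat set) (\<lambda>_. borel :: real measure))}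
         {(\<lambda>\<omega> i. W i \<omega>) -` B \<inter> space Q | B. B \<in> sets (Pi\<^sub>M (UNIV::nat set) (\<lambda>_. Cplus))}"
    and J: "finite J"
  shows "emeasure (distr Q (Pi\<^sub>M UNIV (\<lambda>_. borel)) (\<lambda>\<omega> t. SUP i. ennreal (U i \<omega> * W i \<omega> t)))
         {w. \<forall>s\<in>J. w s \<le> x s}
    = exp_neg (\<integral>\<^sup>+u. emeasure D {w\<in>space Cplus. \<not> (\<forall>s\<in>J. ennreal (u * w s) \<le> x s)} \<partial>frechet_int)"
proof -
  note measurable_Cplus_eval[measurable (raw)] W(1)[measurable]
  have [measurable]: "U i \<in> borel_measurable Q" for i
    using measurable_compose[OF poisson_pp_measurable[OF U] measurable_frechet_int_ident] .
  \<comment> \<open>\<open>S\<close> collects the pairs that respect all levels. It lives over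
    \<open>borel\<close>, the \<sigma>-algebra in which the independence of \<open>U\<close> and
    \<open>W\<close> is expressed.\<close>
  define S :: "(real \<times> ('d \<Rightarrow> real)) set" where
    "S = {p\<in>space (borel \<Otimes>\<^sub>M Cplus). \<forall>s\<in>J. ennreal (fst p * snd p s) \<le> x s}"
  have S: "S \<in> sets (borel \<Otimes>\<^sub>M Cplus)"
    unfolding S_def using J by measurable
  have "(\<lambda>\<omega> t. SUP i. ennreal (U i \<omega> * W i \<omega> t)) \<in> measurable Q (Pi\<^sub>M UNIV (\<lambda>_. borel))"
    by (rule measurable_PiM_single') auto
  moreover have "(\<lambda>\<omega> t. SUP i. ennreal (U i \<omega> * W i \<omega> t)) -` {w. \<forall>s\<in>J. w s \<le> x s} \<inter> space Q
      = {\<omega>\<in>space Q. \<forall>i. (U i \<omega>, W i \<omega>) \<in> S}"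
    using measurable_space[OF W(1)] by (auto simp: S_def SUP_le_iff space_pair_measure)
  moreover have "{w\<in>space Cplus. (u, w) \<notin> S} = {w\<in>space Cplus. \<not> (\<forall>s\<in>J. ennreal (u * w s) \<le> x s)}" for u
    by (auto simp: S_def space_pair_measure)
  ultimately show ?thesis
    using poisson_pp_marking_void[OF U measurable_frechet_int_ident W ind_W ind_UW S]
    by (simp add: emeasure_distr sets_PiM_Iic_cylinder[OF J])
qed

theorem theorem4p1:
  fixes P0 :: "'o measure" and F :: "'o \<Rightarrow> ('d::euclidean_space \<Rightarrow> real)"
    and P :: "'q measure" and X :: "nat \<Rightarrow> 'q \<Rightarrow> real \<times> 'd \<times> ('d \<Rightarrow> real)"
  assumes "prob_space P0"
    and "F \<in> measurable P0 Cspace"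
    and "\<forall>\<omega>\<in>space P0. \<forall>t. 0 < F \<omega> t"
    and "(\<integral>\<^sup>+ \<omega>. (\<integral>\<^sup>+ t. ennreal (F \<omega> t) \<partial>lborel) \<partial>P0) = 1"
    and "poisson_pp P (frechet_int \<Otimes>\<^sub>M (lborel \<Otimes>\<^sub>M distr P0 Cspace F)) X"
  shows "prob_space (incr_law (distr P0 Cspace F)) \<and>
    (AE w in incr_law (distr P0 Cspace F). w 0 = 1) \<and>
    (\<forall>(Q :: 'p measure) (U' :: nat \<Rightarrow> 'p \<Rightarrow> real) (W :: nat \<Rightarrow> 'p \<Rightarrow> ('d \<Rightarrow> real)).
       poisson_pp Q frechet_int U' \<and>
       (\<forall>i. W i \<in> measurable Q Cplus \<and> distr Q Cplus (W i) = incr_law (distr P0 Cspace F)) \<and>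
       prob_space.indep_vars Q (\<lambda>_. Cplus) W UNIV \<and>
       prob_space.indep_set Q
         {(\<lambda>\<omega> i. U' i \<omega>) -` A \<inter> space Q | A. A \<in> sets (Pi\<^sub>M (UNIV::nat set) (\<lambda>_. borel :: real measure))}
         {(\<lambda>\<omega> i. W i \<omega>) -` B \<inter> space Q | B. B \<in> sets (Pi\<^sub>M (UNIV::nat set) (\<lambda>_. Cplus))}
       \<longrightarrow>
       distr P (Pi\<^sub>M UNIV (\<lambda>_. borel))
         (\<lambda>\<omega> t. SUP i. ennreal (fst (X i \<omega>) * snd (snd (X i \<omega>)) (t - fst (snd (X i \<omega>)))))
       = distr Q (Pi\<^sub>M UNIV (\<lambda>_. borel))
         (\<lambda>\<omega> t. SUP i. ennreal (U' i \<omega> * W i \<omega> t)))"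
proof -
  define PF where "PF = distr P0 Cspace F"
  note F = assms(2) and X = assms(5)[folded PF_def]
  have PF: "prob_space PF"
    unfolding PF_def using assms(1) F by (rule prob_space.prob_space_distr)
  have sets_PF: "sets PF = sets Cspace" by (simp add: PF_def)
  have "space Cplus \<inter> space Cspace = (space Cplus :: ('d \<Rightarrow> real) set)"
    by (auto simp: space_Cplus space_Cspace less_imp_le)
  \<comment> \<open>Positivity passes from the sample paths of \<open>F\<close> to their law because
    \<open>space Cplus\<close> is a measurable event of \<open>Cspace\<close>.\<close>
  then have pos: "AE f in PF. f \<in> space Cplus"
    unfolding PF_def using assms(3) sets_Cspace_pos measurable_space[OF F]
    by (subst AE_distr_iff[OF F])
       (auto simp: Int_def conj_commute intro!: AE_I2, auto simp: space_Cplus space_Cspace)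
  \<comment> \<open>Transporting the normalisation from \<open>P0\<close> to \<open>PF\<close>
    requires the total integral to be a measurable functional of the path, which follows from joint
    measurability of evaluation.\<close>
  have "(\<lambda>f. \<integral>\<^sup>+t. ennreal (f t) \<partial>lborel) \<in> borel_measurable (Cspace :: ('d \<Rightarrow> real) measure)"
  proof (rule lborel.borel_measurable_nn_integral)
    have "(\<lambda>p. fst p (snd p)) \<in> borel_measurable (Cspace \<Otimes>\<^sub>M (lborel :: 'd measure))"
      by (rule measurable_Cspace_eval) measurable
    then show "(\<lambda>(f, t). ennreal (f t)) \<in> borel_measurable (Cspace \<Otimes>\<^sub>M (lborel :: 'd measure))"
      by (simp add: case_prod_beta')
  qed
  then have mass: "(\<integral>\<^sup>+f. \<integral>\<^sup>+t. ennreal (f t) \<partial>lborel \<partial>PF) = 1"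
    unfolding PF_def using assms(4) F by (simp add: nn_integral_distr)
  have "distr P (Pi\<^sub>M UNIV (\<lambda>_. borel))
         (\<lambda>\<omega> t. SUP i. ennreal (fst (X i \<omega>) * snd (snd (X i \<omega>)) (t - fst (snd (X i \<omega>)))))
       = distr Q (Pi\<^sub>M UNIV (\<lambda>_. borel)) (\<lambda>\<omega> t. SUP i. ennreal (U' i \<omega> * W i \<omega> t))"
    if U': "poisson_pp Q frechet_int U'"
      and W: "\<And>i. W i \<in> measurable Q Cplus" "\<And>i. distr Q Cplus (W i) = incr_law PF"
      and ind_W: "prob_space.indep_vars Q (\<lambda>_. Cplus) W UNIV"
      and ind_UW: "prob_space.indep_set Q
         {(\<lambda>\<omega> i. U' i \<omega>) -` A \<inter> space Q | A. A \<in> sets (Pi\<^sub>M (UNIV::nat set) (\<lambda>_. borel :: real measure))}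
         {(\<lambda>\<omega> i. W i \<omega>) -` B \<inter> space Q | B. B \<in> sets (Pi\<^sub>M (UNIV::nat set) (\<lambda>_. Cplus))}"
    for Q :: "'p measure" and U' W
  proof (rule measure_eqI_Iic_cylinders)
    show "prob_space (distr P (Pi\<^sub>M UNIV (\<lambda>_. borel))
         (\<lambda>\<omega> t. SUP i. ennreal (fst (X i \<omega>) * snd (snd (X i \<omega>)) (t - fst (snd (X i \<omega>))))))"
      using X by (intro prob_space.prob_space_distr measurable_shifted_max[OF sets_PF])
        (auto simp: poisson_pp_def)
    fix J :: "'d set" and x assume J: "finite J"
    show "emeasure (distr P (Pi\<^sub>M UNIV (\<lambda>_. borel))
         (\<lambda>\<omega> t. SUP i. ennreal (fst (X i \<omega>) * snd (snd (X i \<omega>)) (t - fst (snd (X i \<omega>))))))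
           {w. \<forall>s\<in>J. w s \<le> x s}
       = emeasure (distr Q (Pi\<^sub>M UNIV (\<lambda>_. borel)) (\<lambda>\<omega> t. SUP i. ennreal (U' i \<omega> * W i \<omega> t)))
           {w. \<forall>s\<in>J. w s \<le> x s}"
      unfolding fdd_shifted_max[OF sets_PF J X] fdd_incremental_max[OF U' W ind_W ind_UW J]
        incr_law_intensity[OF PF sets_PF pos J] ..
  qed simp_all
  then show ?thesis
    unfolding PF_def[symmetric]
    using prob_space_incr_law[OF PF sets_PF pos mass] AE_incr_law_0[OF PF sets_PF pos] by blast
qed

end
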